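(* For all $t\in\mathbb{N}$ such that $t\ge 3$, $$gr^t_2(B_4)=\begin{cases} 7 & \text{if } t=3, \\ 8 & \text{if } t\ge 4.\end{cases}$$
   Context: $K_n$ is the complete graph of order $n$. The book $B_n:=K_2+nK_1$ (graph join) is the graph on $n+2$ vertices consisting of an edge $xy$ (the spine) together with $n$ further, pairwise non-adjacent vertices (the pages), each adjacent to both $x$ and $y$. A $t$-coloring of $K_p$ is a map $f:E(K_p)\to\{1,\dots,t\}$, not assumed surjective. A Gallai $t$-coloring is a $t$-coloring with no rainbow triangle, i.e. there are no three vertices $x,y,z$ such that $f(xy),f(xz),f(yz)$ are pairwise distinct. For $1\le s<t$ and a graph $G$, the weakened Gallai-Ramsey number $gr^t_s(G)$ is the least $p\in\mathbb{N}$ such that every Gallai $t$-coloring of $K_p$ contains a (not necessarily induced) subgraph isomorphic to $G$ whose edges use at most $s$ colors. *)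

theory Defs
  imports "HOL-Library.Ramsey" "HOL-Library.FuncSet"
begin

text \<open>A graph is a pair of a vertex set and a set of two-element sets of vertices.
  The set of all two-element subsets of \<open>V\<close> is \<open>nsets V 2\<close>, from the library theory on
  Ramsey's theorem.\<close>

type_synonym 'a graph = "'a set \<times> 'a set set"

abbreviation verts :: "'a graph \<Rightarrow> 'a set" where
  "verts \<equiv> fst"

abbreviation edges :: "'a graph \<Rightarrow> 'a set set" where
  "edges \<equiv> snd"

definition is_graph :: "'a graph \<Rightarrow> bool" where
  "is_graph G \<longleftrightarrow> edges G \<subseteq> nsets (verts G) 2"

definition complete_graph :: "nat \<Rightarrow> nat graph" where
  "complete_graph n = ({..<n}, nsets {..<n} 2)"

definition edgeless_graph :: "nat \<Rightarrow> nat graph" where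
  "edgeless_graph n = ({..<n}, {})"

definition graph_join :: "'a graph \<Rightarrow> 'b graph \<Rightarrow> ('a + 'b) graph" where
  "graph_join G H =
     (verts G <+> verts H,
      (`) Inl ` edges G \<union> (`) Inr ` edges H \<union>
      {{Inl u, Inr v} | u v. u \<in> verts G \<and> v \<in> verts H})"

definition book :: "nat \<Rightarrow> (nat + nat) graph" where
  "book n = graph_join (complete_graph 2) (edgeless_graph n)"

definition subgraph :: "'a graph \<Rightarrow> 'a graph \<Rightarrow> bool" where
  "subgraph H G \<longleftrightarrow> is_graph H \<and> verts H \<subseteq> verts G \<and> edges H \<subseteq> edges G"

definition isomorphic :: "'a graph \<Rightarrow> 'b graph \<Rightarrow> bool" where
  "isomorphic G H \<longleftrightarrow>
     (\<exists>\<phi>. bij_betw \<phi> (verts G) (verts H) \<and>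
          (\<forall>u\<in>verts G. \<forall>v\<in>verts G. {u, v} \<in> edges G \<longleftrightarrow> {\<phi> u, \<phi> v} \<in> edges H))"

definition coloring :: "nat \<Rightarrow> nat \<Rightarrow> (nat set \<Rightarrow> nat) \<Rightarrow> bool" where
  "coloring t p f \<longleftrightarrow> f \<in> edges (complete_graph p) \<rightarrow> {1..t}"

definition rainbow_triangle :: "nat \<Rightarrow> (nat set \<Rightarrow> nat) \<Rightarrow> bool" where
  "rainbow_triangle p f \<longleftrightarrow>
     (\<exists>x\<in>verts (complete_graph p). \<exists>y\<in>verts (complete_graph p). \<exists>z\<in>verts (complete_graph p).
        distinct [x, y, z] \<and> distinct [f {x, y}, f {x, z}, f {y, z}])"

definition gallai_coloring :: "nat \<Rightarrow> nat \<Rightarrow> (nat set \<Rightarrow> nat) \<Rightarrow> bool" where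
  "gallai_coloring t p f \<longleftrightarrow> coloring t p f \<and> \<not> rainbow_triangle p f"

definition gallai_ramsey_property :: "nat \<Rightarrow> nat \<Rightarrow> 'a graph \<Rightarrow> nat \<Rightarrow> bool" where
  "gallai_ramsey_property t s G p \<longleftrightarrow>
     (\<forall>f. gallai_coloring t p f \<longrightarrow>
        (\<exists>H. subgraph H (complete_graph p) \<and> isomorphic G H \<and> card (f ` edges H) \<le> s))"

text \<open>The least \<open>p\<close> with the property. If there were none, the value would be unspecified,
  and no equation \<open>weakened_gallai_ramsey t s G = k\<close> could be derived.\<close>

definition weakened_gallai_ramsey :: "nat \<Rightarrow> nat \<Rightarrow> 'a graph \<Rightarrow> nat" where
  "weakened_gallai_ramsey t s G = (LEAST p. gallai_ramsey_property t s G p)"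

end

theory Submission
  imports Defs
begin

text \<open>In a Gallai colouring the triangles on a spine \<open>xy\<close> of colour \<open>a\<close> use \<open>a\<close> and at most one
  more colour each, so the colouring contains no \<open>B\<^sub>4\<close> in two colours iff for every edge \<open>xy\<close> and
  every colour \<open>d\<close> at most three pages are coloured within \<open>{a, d}\<close>. If an edge of colour \<open>i \<noteq> j\<close>
  leaves \<open>v\<close>, taking it as spine shows that \<open>v\<close> has at most three edges of colour \<open>j\<close>, and that
  three edges of colour \<open>j\<close> force the \<open>i\<close>-neighbourhood of \<open>v\<close> to avoid the colours \<open>i\<close> and \<open>j\<close>.
  By Gallai's decomposition, a Gallai colouring of at least seven vertices cannot satisfy both
  conditions at all vertices, so some vertex is monochromatic. Deleting it, the decomposition
  applies again if there were eight vertices, and seven vertices with three colours are left to a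
  direct argument.\<close>

section \<open>Pages of a spine and the parts of a Gallai colouring\<close>

text \<open>The spine's own colour is always one of the two, so only the second colour
  \<open>d\<close> is free.\<close>

definition pages :: "'a set \<Rightarrow> ('a \<Rightarrow> 'a \<Rightarrow> nat) \<Rightarrow> 'a \<Rightarrow> 'a \<Rightarrow> nat \<Rightarrow> 'a set" where
  "pages W c x y d =
     {w \<in> W. w \<noteq> x \<and> w \<noteq> y \<and> c x w \<in> {c x y, d} \<and> c y w \<in> {c x y, d}}"

text \<open>The vertex set is a parameter of its own, so that vertices can be added and deleted
  under a fixed \<open>c\<close>; the number of colours is left open.\<close>

locale gallai =
  fixes W :: "'a set" and c :: "'a \<Rightarrow> 'a \<Rightarrow> nat"
  assumes fin: "finite W"
    and sym: "c x y = c y x"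
    and no_rainbow: "\<lbrakk>x \<in> W; y \<in> W; z \<in> W; x \<noteq> y; x \<noteq> z; y \<noteq> z\<rbrakk>
      \<Longrightarrow> c x y = c x z \<or> c x y = c y z \<or> c x z = c y z"
begin

definition nbrs :: "'a \<Rightarrow> nat \<Rightarrow> 'a set" where
  "nbrs v k = {u \<in> W. u \<noteq> v \<and> c v u = k}"

definition link :: "nat \<Rightarrow> nat \<Rightarrow> ('a \<times> 'a) set" where
  "link r b = {(u, w). u \<in> W \<and> w \<in> W \<and> u \<noteq> w \<and> c u w \<notin> {r, b}}"

text \<open>Components of the graph formed by all colours other than \<open>r\<close> and
  \<open>b\<close>; when there are several, they are the parts of a Gallai decomposition.\<close>

definition part :: "nat \<Rightarrow> nat \<Rightarrow> 'a \<Rightarrow> 'a set" where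
  "part r b u = (link r b)\<^sup>* `` {u}"

lemma finite_nbrs [simp]: "finite (nbrs v k)"
  using fin by (simp add: nbrs_def)

lemma gallai_subset: "V \<subseteq> W \<Longrightarrow> gallai V c"
  using fin sym no_rainbow by (unfold_locales) (auto dest: finite_subset, blast)

lemma part_refl [simp]: "u \<in> part r b u"
  by (simp add: part_def)

lemma part_sym: "w \<in> part r b u \<longleftrightarrow> u \<in> part r b w"
proof -
  have "sym ((link r b)\<^sup>*)"
    by (rule sym_rtrancl) (auto simp: sym_def link_def sym)
  then show ?thesis by (auto simp: part_def dest: symD)
qed

lemma part_trans: "w \<in> part r b u \<Longrightarrow> z \<in> part r b w \<Longrightarrow> z \<in> part r b u"
  by (auto simp: part_def)

lemma part_subset: assumes "u \<in> W" shows "part r b u \<subseteq> W"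
proof
  fix w assume "w \<in> part r b u"
  then have "(u, w) \<in> (link r b)\<^sup>*" by (simp add: part_def)
  then show "w \<in> W" using assms by induction (auto simp: link_def)
qed

lemma part_closed:
  assumes "u \<in> X" "\<And>x y. x \<in> X \<Longrightarrow> y \<in> W - X \<Longrightarrow> c x y \<in> {r, b}"
  shows "part r b u \<subseteq> X"
proof
  fix w assume "w \<in> part r b u"
  then have "(u, w) \<in> (link r b)\<^sup>*" by (simp add: part_def)
  then show "w \<in> X" using assms by induction (auto simp: link_def)
qed

lemma part_cross:
  assumes "u \<in> W" "w \<in> W" "w \<notin> part r b u"
  shows "c u w \<in> {r, b}"
proof (rule ccontr)
  assume "c u w \<notin> {r, b}"
  moreover have "u \<noteq> w" using assms by auto
  ultimately have "(u, w) \<in> link r b" using assms by (simp add: link_def)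
  then show False using assms by (auto simp: part_def)
qed

text \<open>For a linked pair \<open>w\<close>, \<open>w'\<close> the triangle with \<open>z\<close>
  has one side outside \<open>{r, b}\<close> and two inside, so these two agree; the path from
  \<open>u\<close> transports this. Parts are therefore modules.\<close>

lemma part_const:
  assumes "u \<in> W" "z \<in> W" "z \<notin> part r b u" "w \<in> part r b u"
  shows "c z w = c z u"
proof -
  have "(u, w) \<in> (link r b)\<^sup>*" using assms by (simp add: part_def)
  then show ?thesis
  proof induction
    case (step w w')
    have w: "w \<in> part r b u" "w' \<in> part r b u" using step by (auto simp: part_def)
    have l: "w \<in> W" "w' \<in> W" "w \<noteq> w'" "c w w' \<notin> {r, b}"
      using step by (auto simp: link_def)
    have "z \<notin> part r b w" "z \<notin> part r b w'" using w assms part_trans by blast+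
    then have "c w z \<in> {r, b}" "c w' z \<in> {r, b}" "z \<noteq> w" "z \<noteq> w'"
      using l assms part_cross by auto
    then show ?case using no_rainbow[of z w w'] l assms step sym by auto
  qed simp
qed

end

section \<open>Existence of a two-coloured cut\<close>

text \<open>Induction on the vertex set, adding a vertex \<open>v\<close>: unless some part of the old colouring
  is joined to \<open>v\<close> in \<open>{r, b}\<close> only, all edges at \<open>v\<close> with other colours share one colour \<open>g\<close>,
  and the remaining edges at \<open>v\<close> share one colour too, so \<open>{v}\<close> can be split off.\<close>

lemma gallai_cut:
  assumes "gallai W c" "card W \<ge> 2"
  shows "\<exists>r b X. r \<noteq> b \<and> X \<noteq> {} \<and> X \<subset> W \<and> (\<forall>x\<in>X. \<forall>y\<in>W - X. c x y \<in> {r, b})"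
proof -
  have "finite W" using assms by (simp add: gallai_def)
  then show ?thesis using assms
  proof (induction W)
    case empty
    then show ?case by simp
  next
    case (insert v W)
    interpret big: gallai "insert v W" c by (fact insert.prems)
    interpret gallai W c by (rule big.gallai_subset) auto
    consider u where "W = {u}" | "card W \<ge> 2"
      using insert by (cases "card W") (auto simp: card_1_singleton_iff numeral_2_eq_2 le_Suc_eq dest: card_1_singletonE)
    then show ?case
    proof cases
      case 1
      \<comment> \<open>\<open>Suc (c v u)\<close> is merely some second colour; the only edge has
        colour \<open>c v u\<close>.\<close>
      show ?thesis
        using 1 insert.hyps
        by (intro exI[of _ "c v u"] exI[of _ "Suc (c v u)"] exI[of _ "{v}"]) auto
    next
      case 2
      obtain r b X where rb: "r \<noteq> b" and X: "X \<noteq> {}" "X \<subset> W"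
        and cut: "\<And>x y. x \<in> X \<Longrightarrow> y \<in> W - X \<Longrightarrow> c x y \<in> {r, b}"
        using insert.IH[OF gallai_axioms 2] by blast
      obtain x y where xy: "x \<in> X" "y \<in> W" "y \<notin> X" using X by blast
      have x: "x \<in> W" using xy X by auto
      have ypx: "y \<notin> part r b x" using part_closed[of x X r b] xy cut by blast
      show ?thesis
      proof (cases "\<exists>u\<in>W. \<forall>w\<in>part r b u. c v w \<in> {r, b}")
        case True
        then obtain u where u: "u \<in> W" "\<And>w. w \<in> part r b u \<Longrightarrow> c v w \<in> {r, b}" by blast
        have "c w z \<in> {r, b}" if "w \<in> part r b u" "z \<in> insert v W - part r b u" for w z
        proof (cases "z = v")
          case True
          then show ?thesis using u(2)[OF that(1)] sym by simp
        next
          case False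
          then have "z \<in> W" "w \<in> W" using that part_subset[OF u(1)] by auto
          moreover have "z \<notin> part r b w" using that part_trans by blast
          ultimately show ?thesis using part_cross by blast
        qed
        moreover have "part r b u \<subset> insert v W"
          using part_subset[OF u(1), of r b] insert.hyps by blast
        moreover have "part r b u \<noteq> {}" using part_refl by blast
        ultimately show ?thesis using rb by blast
      next
        case False
        then have ex: "\<exists>w\<in>part r b u. c v w \<notin> {r, b}" if "u \<in> W" for u using that by blast
        \<comment> \<open>The edge \<open>u w\<close> between parts has colour \<open>r\<close> or
          \<open>b\<close>. If neither edge at \<open>v\<close> does, those two must agree; if only
          \<open>v w\<close> does, it must agree with \<open>u w\<close>.\<close>
        have same: "c v u = c v w"
          if "u \<in> W" "w \<in> W" "w \<notin> part r b u" "c v u \<notin> {r, b}" "c v w \<notin> {r, b}" for u w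
          using big.no_rainbow[of v u w] part_cross[of u w r b] that insert.hyps by auto
        have mixed: "c v w = c u w"
          if "u \<in> W" "w \<in> W" "w \<notin> part r b u" "c v u \<notin> {r, b}" "c v w \<in> {r, b}" for u w
          using big.no_rainbow[of v u w] part_cross[of u w r b] that insert.hyps by auto
        obtain x' where x': "x' \<in> part r b x" "c v x' \<notin> {r, b}" using ex[OF x] by blast
        obtain y' where y': "y' \<in> part r b y" "c v y' \<notin> {r, b}" using ex[OF xy(2)] by blast
        have W': "x' \<in> W" "y' \<in> W" using x' y' part_subset x xy by blast+
        \<comment> \<open>A vertex \<open>u\<close> in the part of \<open>x'\<close> is compared
          with \<open>x'\<close> through \<open>y'\<close>, which lies in another part.\<close>
        have g: "c v u = c v x'" if "u \<in> W" "c v u \<notin> {r, b}" for u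
        proof (cases "u \<in> part r b x")
          case True
          then have "u \<notin> part r b y'" "x' \<notin> part r b y'"
            using ypx x' y' part_trans part_sym by metis+
          then show ?thesis using same W' that x' y' by metis
        next
          case False
          then have "u \<notin> part r b x'" using x' part_trans by metis
          then show ?thesis using same W' that x' by metis
        qed
        have s: "c v w = c v w'"
          if wW: "w \<in> W" and wW': "w' \<in> W" and "c v w \<in> {r, b}" and "c v w' \<in> {r, b}" for w w'
        proof (cases "w' \<in> part r b w")
          case True
          obtain z where z: "z \<in> W" "z \<notin> part r b w"
            using x xy(2) ypx part_trans part_sym by metis
          obtain u where u: "u \<in> part r b z" "c v u \<notin> {r, b}" using ex[OF z(1)] by blast
          have uW: "u \<in> W" using u z part_subset by blast
          have "w \<notin> part r b u" "w' \<notin> part r b u" "u \<notin> part r b w"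
            using z u True part_trans part_sym by metis+
          then show ?thesis
            using mixed[of u w] mixed[of u w'] part_const[of w u r b w'] uW u that True by metis
        next
          case False
          \<comment> \<open>Each of the two parts has a vertex joined to \<open>v\<close> outside
            \<open>{r, b}\<close>, so both \<open>c v w\<close> and \<open>c v w'\<close> equal the
            colour between the parts.\<close>
          obtain u where u: "u \<in> part r b w" "c v u \<notin> {r, b}" using ex[OF wW] by blast
          obtain u' where u': "u' \<in> part r b w'" "c v u' \<notin> {r, b}" using ex[OF wW'] by blast
          have uW: "u \<in> W" "u' \<in> W" using u u' that part_subset by blast+
          have n: "w' \<notin> part r b u" "w \<notin> part r b u'" "w \<notin> part r b w'"
            using False u u' part_trans part_sym by metis+
          have "c v w' = c w' u" using mixed[of u w'] n u uW that sym by metis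
          also have "\<dots> = c w' w" using part_const[of w w' r b u] that u False by metis
          also have "\<dots> = c w u'" using part_const[of w' w r b u'] that u' n sym by metis
          also have "\<dots> = c v w" using mixed[of u' w] n u' uW that sym by metis
          finally show ?thesis by simp
        qed
        obtain s where s: "s \<noteq> c v x'" "\<And>w. w \<in> W \<Longrightarrow> c v w \<in> {c v x', s}"
        proof (cases "\<exists>w\<in>W. c v w \<in> {r, b}")
          case True
          then obtain w where w: "w \<in> W" "c v w \<in> {r, b}" by blast
          have "c v w \<noteq> c v x'" using w x' by auto
          moreover have "c v u \<in> {c v x', c v w}" if "u \<in> W" for u
            using g[of u] s[of u w] w that by (cases "c v u \<in> {r, b}") auto
          ultimately show ?thesis by (rule that)
        next
          case False
          \<comment> \<open>Here \<open>v\<close> sees a single colour, and \<open>r\<close> serves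
            as the second one; it differs from \<open>c v x'\<close>, which lies outside
            \<open>{r, b}\<close>.\<close>
          then show ?thesis using g that[of r] x' by auto
        qed
        then show ?thesis using insert.hyps W'
          by (intro exI[of _ "c v x'"] exI[of _ s] exI[of _ "{v}"]) auto
      qed
    qed
  qed
qed

section \<open>Degree bounds against the decomposition\<close>

context gallai
begin

text \<open>The parts are modules joined to each other in \<open>r\<close> or \<open>b\<close>. A singleton part \<open>{v}\<close> has three
  edges of each of these colours, and its two neighbourhoods form only two further parts, one of
  them joined to \<open>v\<close> and to the other one in the same colour. If all parts have at least two
  vertices, each of them sees parts in both colours, but no part sees two others in one colour.\<close>

lemma some_large_degree:
  assumes seven: "card W \<ge> 7"
    and deg: "\<And>v k. v \<in> W \<Longrightarrow> card (nbrs v k) \<le> 3"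
    and free: "\<And>v r b y z. \<lbrakk>v \<in> W; r \<noteq> b; card (nbrs v r) = 3; card (nbrs v b) = 3;
      y \<in> nbrs v r; z \<in> nbrs v r; y \<noteq> z\<rbrakk> \<Longrightarrow> c y z \<notin> {r, b}"
  shows False
proof -
  have "card W \<ge> 2" using seven by simp
  from gallai_cut[OF gallai_axioms this]
  obtain r b X where rb: "r \<noteq> b" and X: "X \<noteq> {}" "X \<subset> W"
    and cut: "\<And>x y. x \<in> X \<Longrightarrow> y \<in> W - X \<Longrightarrow> c x y \<in> {r, b}"
    by blast
  let ?P = "part r b"
  have split: "\<exists>u\<in>W. u \<notin> ?P v" if "v \<in> W" for v
  proof -
    obtain x y where xy: "x \<in> X" "y \<in> W" "y \<notin> X" using X by blast
    then have "y \<notin> ?P x" using part_closed[of x X r b] cut by blast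
    then show ?thesis using xy X part_trans part_sym by (metis psubsetD)
  qed
  have finP: "finite (?P v)" if "v \<in> W" for v
    using that part_subset fin finite_subset by metis
  \<comment> \<open>Being a module, a part lies in one colour neighbourhood of any vertex outside
    it, so the degree bounds limit its size.\<close>
  have into: "?P v \<subseteq> nbrs u (c u v)" if "u \<in> W" "v \<in> W" "u \<notin> ?P v" for u v
  proof
    fix w assume "w \<in> ?P v"
    then have "w \<in> W" "w \<noteq> u" "c u w = c u v"
      using that part_const[of v u r b w] part_subset[of v r b] by blast+
    then show "w \<in> nbrs u (c u v)" by (simp add: nbrs_def)
  qed
  have small: "card (?P v) \<le> 3" if v: "v \<in> W" for v
  proof -
    obtain u where u: "u \<in> W" "u \<notin> ?P v" using split[OF v] by blast
    then have "card (?P v) \<le> card (nbrs u (c u v))" using into v by (intro card_mono) auto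
    then show ?thesis using deg[OF u(1), of "c u v"] by linarith
  qed
  have big: "card (?P v) \<ge> 2" if v: "v \<in> W" for v
  proof (rule ccontr)
    assume "\<not> ?thesis"
    moreover have "card (?P v) \<noteq> 0" using finP[OF v] part_refl by (metis card_0_eq empty_iff)
    ultimately have "card (?P v) = 1" by simp
    then have single: "?P v = {v}" using part_refl by (metis card_1_singletonE singletonD)
    have W: "W = insert v (nbrs v r \<union> nbrs v b)"
      using part_cross[OF v, of _ r b] single v by (auto simp: nbrs_def)
    have "card W \<le> Suc (card (nbrs v r \<union> nbrs v b))"
      using arg_cong[OF W, of card] card_insert_le_m1[of "Suc (card (nbrs v r \<union> nbrs v b))" _ v] by simp
    also have "\<dots> \<le> Suc (card (nbrs v r) + card (nbrs v b))"
      using card_Un_le[of "nbrs v r" "nbrs v b"] by simp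
    finally have "card W \<le> Suc (card (nbrs v r) + card (nbrs v b))" .
    \<comment> \<open>Seven vertices give \<open>v\<close> six neighbours, so both degrees are
      exactly 3 and \<open>free\<close> applies in both colours.\<close>
    then have three: "card (nbrs v r) = 3" "card (nbrs v b) = 3"
      using seven deg[OF v, of r] deg[OF v, of b] by linarith+
    have nW: "nbrs v k \<subseteq> W" for k by (auto simp: nbrs_def)
    have r_in: "nbrs v r \<subseteq> ?P y" if "y \<in> nbrs v r" for y
      using free[OF v rb three that] part_cross[of y _ r b] nW that part_refl by blast
    have b_in: "nbrs v b \<subseteq> ?P y" if "y \<in> nbrs v b" for y
      using free[OF v rb[symmetric] three(2,1) that] part_cross[of y _ r b] nW that part_refl by blast
    obtain y u where y: "y \<in> nbrs v r" and u: "u \<in> nbrs v b"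
      using three by (metis all_not_in_conv card.empty zero_neq_numeral)
    have ne: "v \<notin> ?P y" using single y part_sym by (auto simp: nbrs_def)
    have uy: "u \<notin> ?P y"
    proof
      assume "u \<in> ?P y"
      then have "c v u = c v y" using part_const[of y v r b u] ne y v by (auto simp: nbrs_def)
      then show False using u y rb by (auto simp: nbrs_def)
    qed
    have yu: "y \<notin> ?P u" using uy part_sym by blast
    have uyW: "u \<in> W" "y \<in> W" using u y nW by auto
    have "c u y \<in> {r, b}" using part_cross[of u y r b] uyW yu by blast
    then show False
    proof
      \<comment> \<open>Here \<open>y\<close> sends colour \<open>r\<close> to \<open>v\<close> and
        to all three \<open>b\<close>-neighbours of \<open>v\<close>, four edges in all; the other
        case is symmetric, with \<open>u\<close> in place of \<open>y\<close>.\<close>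
      assume cr: "c u y = r"
      have "insert v (nbrs v b) \<subseteq> nbrs y r"
      proof -
        have "nbrs v b \<subseteq> nbrs y (c y u)" using b_in[OF u] into[of y u] uyW yu by blast
        then show ?thesis using cr y v sym by (auto simp: nbrs_def)
      qed
      then have "card (insert v (nbrs v b)) \<le> 3" using deg[OF uyW(2)] card_mono finite_nbrs le_trans by meson
      then show False using three by (simp add: card_insert_if) (simp add: nbrs_def)
    next
      assume "c u y \<in> {b}"
      then have cb: "c u y = b" by simp
      have "insert v (nbrs v r) \<subseteq> nbrs u b"
      proof -
        have "nbrs v r \<subseteq> nbrs u (c u y)" using r_in[OF y] into[of u y] uyW uy by blast
        then show ?thesis using cb u v sym by (auto simp: nbrs_def)
      qed
      then have "card (insert v (nbrs v r)) \<le> 3" using deg[OF uyW(1)] card_mono finite_nbrs le_trans by meson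
      then show False using three by (simp add: card_insert_if) (simp add: nbrs_def)
    qed
  qed
  have two: False
    if "v \<in> W" "w \<in> W" "u \<in> W" "w \<notin> ?P v" "u \<notin> ?P v" "u \<notin> ?P w" "c u v = c u w" for u v w
  proof -
    have "?P v \<inter> ?P w = {}" using that part_trans part_sym by blast
    then have "card (?P v \<union> ?P w) \<ge> 4"
      using big[OF that(1)] big[OF that(2)] finP that by (simp add: card_Un_disjoint)
    moreover have "card (?P v \<union> ?P w) \<le> card (nbrs u (c u v))"
      using into[of u v] into[of u w] that by (intro card_mono) auto
    ultimately show False
      using deg[OF that(3), of "c u v"] by linarith
  qed
  obtain v where v: "v \<in> W" using seven by (cases "W = {}") auto
  let ?N = "\<lambda>k. nbrs v k - ?P v"
  have "W \<subseteq> ?P v \<union> (?N r \<union> ?N b)"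
    using part_cross[OF v, of _ r b] part_refl[of v r b] by (fastforce simp: nbrs_def)
  then have "card W \<le> card (?P v \<union> (?N r \<union> ?N b))"
    using finP[OF v] by (intro card_mono) auto
  then have le: "card W \<le> card (?P v) + (card (?N r) + card (?N b))"
    using card_Un_le[of "?P v" "?N r \<union> ?N b"] card_Un_le[of "?N r" "?N b"] by linarith
  have N: "card (?N k) \<le> 3" for k
    using deg[OF v, of k] card_mono[OF finite_nbrs, of "?N k" v k] by auto
  with N[of r] N[of b] le have "card (?N r) \<noteq> 0" "card (?N b) \<noteq> 0"
    using small[OF v] seven by linarith+
  then have "?N r \<noteq> {}" "?N b \<noteq> {}" by (metis card.empty)+
  then obtain u w where u: "u \<in> W" "c v u = r" "u \<notin> ?P v" and w: "w \<in> W" "c v w = b" "w \<notin> ?P v"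
    by (auto simp: nbrs_def)
  have wu: "w \<notin> ?P u"
  proof
    assume "w \<in> ?P u"
    then have "c v w = c v u" using part_const[of u v r b w] u v part_sym by blast
    then show False using u w rb by simp
  qed
  \<comment> \<open>Colour \<open>r\<close> would let \<open>u\<close> see two parts in
    \<open>r\<close>, colour \<open>b\<close> would let \<open>w\<close> see two parts in
    \<open>b\<close>.\<close>
  have "c u w \<in> {r, b}" using part_cross[OF u(1) w(1) wu] .
  then show False
    using two[of v w u] two[of v u w] u w v wu part_sym sym by (metis insertE singletonD)
qed

section \<open>From page counts to degrees\<close>

text \<open>On the spine \<open>v y\<close> of colour \<open>i\<close>, an edge \<open>v w\<close>
  of colour \<open>j\<close> forces \<open>c y w\<close> into \<open>{i, j}\<close>, so every
  \<open>j\<close>-neighbour of \<open>v\<close> is a page. An \<open>i\<close>-neighbour is a page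
  only if its edge to \<open>y\<close> also has one of these colours.\<close>

lemma card_pages:
  assumes i: "y \<in> nbrs v i" and v: "v \<in> W" and "j \<noteq> i"
  shows "card (nbrs v j) + card {w \<in> nbrs v i. w \<noteq> y \<and> c y w \<in> {i, j}} \<le> card (pages W c v y j)"
proof -
  let ?S = "{w \<in> nbrs v i. w \<noteq> y \<and> c y w \<in> {i, j}}"
  have "nbrs v j \<subseteq> pages W c v y j"
  proof
    fix w assume "w \<in> nbrs v j"
    then show "w \<in> pages W c v y j"
      using no_rainbow[of v y w] assms by (cases "w = y") (auto simp: nbrs_def pages_def)
  qed
  moreover have "?S \<subseteq> pages W c v y j"
    using i by (auto simp: nbrs_def pages_def)
  ultimately have "card (nbrs v j \<union> ?S) \<le> card (pages W c v y j)"
    using fin by (intro card_mono) (auto simp: pages_def)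
  moreover have "nbrs v j \<inter> ?S = {}" using assms by (auto simp: nbrs_def)
  ultimately show ?thesis by (simp add: card_Un_disjoint)
qed

text \<open>Three \<open>b\<close>-neighbours of \<open>v\<close> exhaust the pages allowed, so an
  edge of colour \<open>r\<close> or \<open>b\<close> inside \<open>nbrs v r\<close> would supply a
  fourth.\<close>

lemma free_of_degree:
  assumes pages: "\<And>x y d. \<lbrakk>x \<in> W; y \<in> W; x \<noteq> y\<rbrakk> \<Longrightarrow> card (pages W c x y d) \<le> 3"
    and "v \<in> W" "r \<noteq> b" "card (nbrs v b) \<ge> 3" "y \<in> nbrs v r" "z \<in> nbrs v r" "y \<noteq> z"
  shows "c y z \<notin> {r, b}"
proof
  assume "c y z \<in> {r, b}"
  then have "{w \<in> nbrs v r. w \<noteq> y \<and> c y w \<in> {r, b}} \<noteq> {}" using assms by blast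
  then have "card {w \<in> nbrs v r. w \<noteq> y \<and> c y w \<in> {r, b}} > 0" by (simp add: card_gt_0_iff)
  moreover have "y \<in> W" "v \<noteq> y" using assms by (auto simp: nbrs_def)
  ultimately show False
    using card_pages[of y v r b] pages[of v y b] assms by linarith
qed

text \<open>A spine at \<open>v\<close> of a colour other than \<open>k\<close> bounds the number of
  edges of colour \<open>k\<close> there. If no vertex is monochromatic, such spines exist for all
  \<open>v\<close> and \<open>k\<close>, and \<open>some_large_degree\<close> gives a
  contradiction.\<close>

lemma monochromatic_vertex:
  assumes pages: "\<And>x y d. \<lbrakk>x \<in> W; y \<in> W; x \<noteq> y\<rbrakk> \<Longrightarrow> card (pages W c x y d) \<le> 3"
    and "card W \<ge> 7"
  obtains x i where "x \<in> W" "\<And>u. u \<in> W \<Longrightarrow> u \<noteq> x \<Longrightarrow> c x u = i"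
proof -
  have "\<exists>x\<in>W. \<exists>i. \<forall>u\<in>W. u \<noteq> x \<longrightarrow> c x u = i"
  proof (rule ccontr)
    assume neg: "\<not> ?thesis"
    have deg: "card (nbrs v k) \<le> 3" if v: "v \<in> W" for v k
    proof -
      obtain y where y: "y \<in> W" "y \<noteq> v" "c v y \<noteq> k" using neg v by blast
      then have "y \<in> nbrs v (c v y)" by (simp add: nbrs_def)
      then show ?thesis using card_pages[of y v "c v y" k] y pages[of v y k] v by fastforce
    qed
    show False
    proof (rule some_large_degree[OF assms(2) deg])
      fix v r b y z
      assume "v \<in> W" "r \<noteq> b" "card (nbrs v b) = 3" "y \<in> nbrs v r" "z \<in> nbrs v r" "y \<noteq> z"
      then show "c y z \<notin> {r, b}" using free_of_degree[OF pages, of v r b y z] by simp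
    qed
  qed
  then show thesis using that by blast
qed

text \<open>On a spine through the monochromatic vertex \<open>x\<close> the condition on
  \<open>c x w\<close> holds automatically, so being a page depends on \<open>c y w\<close>
  alone.\<close>

lemma apex_degree:
  assumes pages: "\<And>x y d. \<lbrakk>x \<in> W; y \<in> W; x \<noteq> y\<rbrakk> \<Longrightarrow> card (pages W c x y d) \<le> 3"
    and apex: "x \<in> W" "\<And>u. u \<in> W \<Longrightarrow> u \<noteq> x \<Longrightarrow> c x u = i"
    and y: "y \<in> W - {x}"
  shows "card {w \<in> W - {x}. w \<noteq> y \<and> c y w \<in> {i, d}} \<le> 3"
proof -
  have "{w \<in> W - {x}. w \<noteq> y \<and> c y w \<in> {i, d}} \<subseteq> pages W c x y d"
    using apex y by (auto simp: pages_def)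
  then have "card {w \<in> W - {x}. w \<noteq> y \<and> c y w \<in> {i, d}} \<le> card (pages W c x y d)"
    using fin by (intro card_mono) (auto simp: pages_def)
  also have "\<dots> \<le> 3" using pages apex y by auto
  finally show ?thesis .
qed

section \<open>Upper bounds: eight vertices, and seven vertices with three colours\<close>

text \<open>Spines through the apex bound all degrees among the other vertices, so it does not
  matter whether one of those is monochromatic in turn.\<close>

lemma no_bookfree_8:
  assumes pages: "\<And>x y d. \<lbrakk>x \<in> W; y \<in> W; x \<noteq> y\<rbrakk> \<Longrightarrow> card (pages W c x y d) \<le> 3"
    and eight: "card W \<ge> 8"
  shows False
proof -
  have "card W \<ge> 7" using eight by simp
  from monochromatic_vertex[OF pages this]
  obtain x i where x: "x \<in> W" "\<And>u. u \<in> W \<Longrightarrow> u \<noteq> x \<Longrightarrow> c x u = i" by metis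
  interpret A: gallai "W - {x}" c by (rule gallai_subset) auto
  have sub: "A.nbrs v k \<subseteq> nbrs v k" for v k by (auto simp: nbrs_def A.nbrs_def)
  show False
  proof (rule A.some_large_degree)
    show "card (W - {x}) \<ge> 7" using eight x by (simp add: fin)
  next
    fix v k assume v: "v \<in> W - {x}"
    have "card (A.nbrs v k) \<le> card {w \<in> W - {x}. w \<noteq> v \<and> c v w \<in> {i, k}}"
      using fin by (intro card_mono) (auto simp: A.nbrs_def)
    also have "\<dots> \<le> 3" using apex_degree[OF pages x v] .
    finally show "card (A.nbrs v k) \<le> 3" .
  next
    fix v r b y z
    assume *: "v \<in> W - {x}" "r \<noteq> b" "card (A.nbrs v b) = 3"
      "y \<in> A.nbrs v r" "z \<in> A.nbrs v r" "y \<noteq> z"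
    have "card (nbrs v b) \<ge> 3" using card_mono[OF finite_nbrs sub, of v b] * by simp
    then show "c y z \<notin> {r, b}"
      using free_of_degree[OF pages, of v r b y z] * sub by blast
  qed
qed

text \<open>The edges of the colour \<open>i\<close> of the monochromatic vertex \<open>x\<close> form a perfect matching of the
  other six vertices, whose three pairs are modules. Each pair is joined to one other pair in
  \<open>j\<close> and to the other one in \<open>k\<close>, which is impossible for three pairs.\<close>

lemma no_bookfree_7:
  assumes pages: "\<And>x y d. \<lbrakk>x \<in> W; y \<in> W; x \<noteq> y\<rbrakk> \<Longrightarrow> card (pages W c x y d) \<le> 3"
    and seven: "card W = 7"
    and three: "card K = 3" "\<And>u v. \<lbrakk>u \<in> W; v \<in> W; u \<noteq> v\<rbrakk> \<Longrightarrow> c u v \<in> K"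
  shows False
proof -
  have "card W \<ge> 7" using seven by simp
  from monochromatic_vertex[OF pages this]
  obtain x i where x: "x \<in> W" "\<And>u. u \<in> W \<Longrightarrow> u \<noteq> x \<Longrightarrow> c x u = i" by metis
  define A where "A = W - {x}"
  have cardA: "card A = 6" and finA: "finite A" and AW: "A \<subseteq> W"
    using seven x fin by (auto simp: A_def)
  then obtain u where "u \<in> A" by fastforce
  then have "i \<in> K" using three(2)[of x u] x by (auto simp: A_def)
  then have "card (K - {i}) = 2" using three(1) by simp
  then obtain j k where jk: "K - {i} = {j, k}" "j \<noteq> k" by (auto simp: card_2_iff)
  have ij: "i \<noteq> j" "i \<noteq> k" using jk by auto
  have col: "c u v = i \<or> c u v = j \<or> c u v = k" if "u \<in> A" "v \<in> A" "u \<noteq> v" for u v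
    using three(2)[of u v] that jk AW by blast
  interpret A: gallai A c by (rule gallai_subset[OF AW])
  have half: "card {w \<in> A. w \<noteq> y \<and> c y w \<in> {i, d}} \<le> 3" if "y \<in> A" for y d
    using apex_degree[OF pages x, of y d] that by (simp add: A_def)
  have half': "card (A.nbrs y i) + card (A.nbrs y d) \<le> 3" if "y \<in> A" "d \<noteq> i" for y d
  proof -
    have "{w \<in> A. w \<noteq> y \<and> c y w \<in> {i, d}} = A.nbrs y i \<union> A.nbrs y d"
      by (auto simp: A.nbrs_def)
    moreover have "A.nbrs y i \<inter> A.nbrs y d = {}" using that by (auto simp: A.nbrs_def)
    ultimately show ?thesis using half[OF that(1), of d] by (simp add: card_Un_disjoint)
  qed
  have total: "card (A.nbrs y i) + card (A.nbrs y j) + card (A.nbrs y k) = 5" if "y \<in> A" for y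
  proof -
    have "A - {y} = A.nbrs y i \<union> A.nbrs y j \<union> A.nbrs y k"
      using col that by (auto simp: A.nbrs_def)
    moreover have "card (A - {y}) = 5" using that cardA finA by simp
    moreover have "A.nbrs y i \<inter> A.nbrs y j = {}" "(A.nbrs y i \<union> A.nbrs y j) \<inter> A.nbrs y k = {}"
      using ij jk by (auto simp: A.nbrs_def)
    ultimately show ?thesis by (simp add: card_Un_disjoint)
  qed
  \<comment> \<open>The degrees in \<open>i\<close> and \<open>j\<close>, and those in
    \<open>i\<close> and \<open>k\<close>, add up to at most 3, while all three add up to 5; hence
    the degree in \<open>i\<close> is at most 1.\<close>
  have match: "w = z" if "y \<in> A" "w \<in> A" "z \<in> A" "w \<noteq> y" "z \<noteq> y" "c y w = i" "c y z = i" for y w z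
  proof -
    have "card (A.nbrs y i) \<le> Suc 0"
      using total[OF that(1)] half'[OF that(1), of j] half'[OF that(1), of k] ij by linarith
    moreover have "w \<in> A.nbrs y i" "z \<in> A.nbrs y i" using that by (auto simp: A.nbrs_def)
    ultimately show ?thesis using card_le_Suc0_iff_eq[OF A.finite_nbrs] by blast
  qed
  \<comment> \<open>Two vertices of \<open>A\<close> without an edge of colour \<open>i\<close>
    inside \<open>A\<close> would form a spine with the other four vertices of \<open>A\<close> as
    pages in \<open>j\<close> and \<open>k\<close>.\<close>
  have mate: "\<exists>w\<in>A. (w \<noteq> y \<and> c y w = i) \<or> (w \<noteq> z \<and> c z w = i)"
    if yz: "y \<in> A" "z \<in> A" "y \<noteq> z" for y z
  proof (rule ccontr)
    assume neg: "\<not> ?thesis"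
    then have "c y z \<noteq> i" using yz by auto
    then obtain d where d: "{c y z, d} = {j, k}" using col[OF yz] by blast
    have "A - {y, z} \<subseteq> pages W c y z d"
      unfolding pages_def d using neg col yz AW by blast
    then have "card (A - {y, z}) \<le> card (pages W c y z d)"
      using fin by (intro card_mono) (auto simp: pages_def)
    moreover have "card (A - {y, z}) = 4" using yz cardA finA by (simp add: card_Diff_subset)
    ultimately show False using pages[of y z d] yz AW by auto
  qed
  have "\<not> card A \<le> Suc 0" using cardA by simp
  then obtain a b where "a \<in> A" "b \<in> A" "a \<noteq> b" using finA by (auto simp: card_le_Suc0_iff_eq)
  then obtain y y' where y: "y \<in> A" "y' \<in> A" "y' \<noteq> y" "c y y' = i" using mate by blast
  have y'y: "c y' y = i" using y sym by simp
  have noti: "c y w \<noteq> i" "c y' w \<noteq> i" if "w \<in> A" "w \<noteq> y" "w \<noteq> y'" for w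
    using match[of y w y'] match[of y' w y] y y'y that by auto
  have pair: "c y' w = c y w" if "w \<in> A" "w \<noteq> y" "w \<noteq> y'" for w
    using A.no_rainbow[of y y' w] noti[OF that] y that by auto
  \<comment> \<open>On the spine \<open>y y'\<close> the apex \<open>x\<close> is one page, which
    leaves only two for the \<open>d\<close>-neighbours.\<close>
  have two: "card (A.nbrs y d) \<le> 2" if "d \<noteq> i" for d
  proof -
    have "insert x (A.nbrs y d) \<subseteq> pages W c y y' d"
    proof
      fix w assume "w \<in> insert x (A.nbrs y d)"
      then show "w \<in> pages W c y y' d"
      proof
        assume "w = x"
        then show ?thesis using x y AW sym[of _ x] by (auto simp: pages_def A_def)
      next
        assume "w \<in> A.nbrs y d"
        then show ?thesis using pair[of w] y that AW by (auto simp: pages_def A.nbrs_def)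
      qed
    qed
    then have "card (insert x (A.nbrs y d)) \<le> card (pages W c y y' d)"
      using fin by (intro card_mono) (auto simp: pages_def)
    moreover have "x \<notin> A.nbrs y d" unfolding A.nbrs_def by (simp add: A_def)
    ultimately show ?thesis using pages[of y y' d] y AW by (simp add: subset_iff)
  qed
  have "card (A.nbrs y i) + card (A.nbrs y j) \<le> 3" "card (A.nbrs y i) + card (A.nbrs y k) \<le> 3"
    using half'[OF y(1)] ij by auto
  then have "card (A.nbrs y j) = 2" "card (A.nbrs y k) = 2"
    using total[OF y(1)] two[of j] two[of k] ij by linarith+
  then obtain p p' q q' where p: "A.nbrs y j = {p, p'}" "p \<noteq> p'" and q: "A.nbrs y k = {q, q'}" "q \<noteq> q'"
    by (auto simp: card_2_iff)
  have mates: "c p p' = i" if P: "A.nbrs y d = {p, p'}" "p \<noteq> p'" "d \<noteq> i" for p p' d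
  proof -
    \<comment> \<open>An edge of colour \<open>i\<close> leaving \<open>A.nbrs y d\<close> would
      form a rainbow triangle with \<open>y\<close>. So the partner that \<open>mate\<close>
      supplies for \<open>p\<close> or \<open>p'\<close> is the other of the two.\<close>
    have closed: "w \<in> A.nbrs y d" if w: "w \<in> A" "v \<in> A.nbrs y d" "w \<noteq> v" "c v w = i" for v w
    proof -
      have v: "v \<in> A" "v \<noteq> y" "c y v = d" using w by (auto simp: A.nbrs_def)
      then have "v \<noteq> y'" using y P by auto
      then have "w \<noteq> y" "w \<noteq> y'" using noti[of v] v w sym by auto
      then have "c y w \<noteq> i" using noti w by auto
      then have "c y w = d"
        using A.no_rainbow[of y v w] v w y P \<open>w \<noteq> y\<close> by auto
      then show ?thesis using w \<open>w \<noteq> y\<close> by (simp add: A.nbrs_def)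
    qed
    have in_P: "p \<in> A.nbrs y d" "p' \<in> A.nbrs y d" using P by auto
    then have "p \<in> A" "p' \<in> A" by (auto simp: A.nbrs_def)
    then obtain w where w: "w \<in> A" "w \<noteq> p \<and> c p w = i \<or> w \<noteq> p' \<and> c p' w = i"
      using mate[of p p'] P by blast
    then have "w \<in> {p, p'}" using closed[of w p] closed[of w p'] in_P P(1) by blast
    then show ?thesis using w sym[of p p'] by auto
  qed
  have pp: "c p p' = i" and qq: "c q q' = i" using mates p q ij by auto
  have "p \<in> A.nbrs y j" "p' \<in> A.nbrs y j" "q \<in> A.nbrs y k" "q' \<in> A.nbrs y k" using p q by auto
  then have P: "p \<in> A" "p' \<in> A" "p \<noteq> y" "p' \<noteq> y" "c y p = j" "c y p' = j"
    and Q: "q \<in> A" "q' \<in> A" "q \<noteq> y" "q' \<noteq> y" "c y q = k" "c y q' = k"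
    by (auto simp: A.nbrs_def)
  have ne: "p \<noteq> y'" "p' \<noteq> y'" "q \<noteq> y'" "q' \<noteq> y'" "p \<noteq> q" "p \<noteq> q'" "p' \<noteq> q" "p' \<noteq> q'"
    using P Q y(4) ij jk(2) by metis+
  have npq: "c p q \<noteq> i" "c p q' \<noteq> i" "c q p' \<noteq> i"
    using match[of p p' q] match[of p p' q'] match[of q q' p'] P Q p(2) q(2) pp qq ne by metis+
  have eq: "c p q' = c p q" "c q p' = c q p"
    using A.no_rainbow[of p q q'] A.no_rainbow[of q p p'] P Q p(2) q(2) pp qq ne npq sym
    by metis+
  have four: False if "v \<in> A" "S \<subseteq> A.nbrs v d" "card S = 4" "d \<noteq> i" for v S d
    using half'[OF that(1,4)] card_mono[OF A.finite_nbrs that(2)] that(3) by linarith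
  \<comment> \<open>If \<open>p q\<close> has colour \<open>j\<close>, then \<open>p\<close> sees
    both other pairs in \<open>j\<close>; otherwise \<open>q\<close> sees both other pairs in
    \<open>k\<close>.\<close>
  have "c p q = j \<or> c p q = k" using col[of p q] P Q ne npq by metis
  then show False
  proof
    assume "c p q = j"
    then have "{y, y', q, q'} \<subseteq> A.nbrs p j"
      using P Q y ne eq pair[of p] sym[of p y] sym[of p y'] by (auto simp: A.nbrs_def)
    moreover have "card {y, y', q, q'} = 4" using Q y ne q(2) by simp
    ultimately show False using four P(1) ij(1) by metis
  next
    assume "c p q = k"
    then have "{y, y', p, p'} \<subseteq> A.nbrs q k"
      using P Q y ne eq pair[of q] sym[of q y] sym[of q y'] sym[of q p] by (auto simp: A.nbrs_def)
    moreover have "card {y, y', p, p'} = 4" using P y ne p(2) by simp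
    ultimately show False using four Q(1) ij(2) by metis
  qed
qed

end

section \<open>Two-coloured copies of a book as page counts\<close>

lemma is_graph_book: "is_graph (book n)"
  by (auto simp: is_graph_def book_def graph_join_def complete_graph_def edgeless_graph_def
      nsets_def card_image finite_imageI)

lemma edges_book: "edges (book n) =
  insert {Inl 0, Inl 1} {{Inl u, Inr v} | u v. u < 2 \<and> v < n}"
proof -
  have "nsets {..<2::nat} 2 = {{0, 1}}"
    by (auto simp: nsets_def card_2_iff less_2_cases_iff doubleton_eq_iff)
  then show ?thesis
    by (auto simp: book_def graph_join_def complete_graph_def edgeless_graph_def)
qed

lemma verts_book: "verts (book n) = {..<2} <+> {..<n}"
  by (simp add: book_def graph_join_def complete_graph_def edgeless_graph_def)

lemma is_graph_image:
  assumes "is_graph G" "inj_on \<phi> (verts G)"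
  shows "is_graph (\<phi> ` verts G, (`) \<phi> ` edges G)"
proof -
  have "\<phi> ` e \<in> nsets (\<phi> ` verts G) 2" if "e \<in> edges G" for e
  proof -
    have "e \<subseteq> verts G" "finite e" "card e = 2"
      using assms(1) that by (auto simp: is_graph_def nsets_def)
    moreover from this have "card (\<phi> ` e) = 2"
      using assms(2) by (metis card_image inj_on_subset)
    ultimately show ?thesis by (auto simp: nsets_def)
  qed
  then show ?thesis by (auto simp: is_graph_def)
qed

lemma isomorphic_image:
  assumes "is_graph G" "inj_on \<phi> (verts G)"
  shows "isomorphic G (\<phi> ` verts G, (`) \<phi> ` edges G)"
proof -
  have "{u, v} \<in> edges G \<longleftrightarrow> {\<phi> u, \<phi> v} \<in> (`) \<phi> ` edges G"
    if uv: "u \<in> verts G" "v \<in> verts G" for u v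
  proof
    assume "{u, v} \<in> edges G"
    then have "\<phi> ` {u, v} \<in> (`) \<phi> ` edges G" by (rule imageI)
    then show "{\<phi> u, \<phi> v} \<in> (`) \<phi> ` edges G" by simp
  next
    assume "{\<phi> u, \<phi> v} \<in> (`) \<phi> ` edges G"
    then obtain e where e: "e \<in> edges G" "\<phi> ` e = \<phi> ` {u, v}" by auto
    moreover have "e \<subseteq> verts G" using assms(1) e by (auto simp: is_graph_def nsets_def)
    ultimately have "e = {u, v}" using inj_on_image_eq_iff[OF assms(2), of e "{u, v}"] uv by simp
    then show "{u, v} \<in> edges G" using e by simp
  qed
  then show ?thesis
    using assms(2) by (auto simp: isomorphic_def bij_betw_def intro!: exI[of _ \<phi>])
qed


text \<open>The images of \<open>Inl 0\<close> and \<open>Inl 1\<close> are the spine of a copy;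
  conversely, any \<open>n\<close> pages span a copy.\<close>

lemma two_colored_book_iff:
  "(\<exists>H. subgraph H (complete_graph p) \<and> isomorphic (book n) H \<and> card (f ` edges H) \<le> 2) \<longleftrightarrow>
   (\<exists>x<p. \<exists>y<p. x \<noteq> y \<and> (\<exists>d. n \<le> card (pages {..<p} (\<lambda>u v. f {u, v}) x y d)))"
  (is "?L \<longleftrightarrow> ?R")
proof
  assume ?L
  then obtain H \<phi> where H: "subgraph H (complete_graph p)" "card (f ` edges H) \<le> 2"
    and \<phi>: "bij_betw \<phi> (verts (book n)) (verts H)"
      "\<And>u v. \<lbrakk>u \<in> verts (book n); v \<in> verts (book n)\<rbrakk>
        \<Longrightarrow> {u, v} \<in> edges (book n) \<longleftrightarrow> {\<phi> u, \<phi> v} \<in> edges H"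
    unfolding isomorphic_def by blast
  define x y where "x = \<phi> (Inl 0)" and "y = \<phi> (Inl 1)"
  have V: "Inl 0 \<in> verts (book n)" "Inl 1 \<in> verts (book n)"
    "\<And>i. i < n \<Longrightarrow> Inr i \<in> verts (book n)"
    by (auto simp: verts_book)
  have inj: "inj_on \<phi> (verts (book n))" and im: "\<phi> ` verts (book n) \<subseteq> {..<p}"
    using \<phi>(1) H by (auto simp: bij_betw_def subgraph_def complete_graph_def)
  have xy: "x < p" "y < p" "x \<noteq> y"
    using V im inj by (auto simp: x_def y_def inj_on_def)
  have E: "{x, y} \<in> edges H" "\<And>i. i < n \<Longrightarrow> {x, \<phi> (Inr i)} \<in> edges H"
    "\<And>i. i < n \<Longrightarrow> {y, \<phi> (Inr i)} \<in> edges H"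
  proof -
    have "{Inl a, Inr i} \<in> edges (book n)" if "a < 2" "i < n" for a i
      unfolding edges_book using that by blast
    moreover have "{Inl 0, Inl 1} \<in> edges (book n)" by (simp add: edges_book)
    ultimately show "{x, y} \<in> edges H" "\<And>i. i < n \<Longrightarrow> {x, \<phi> (Inr i)} \<in> edges H"
      "\<And>i. i < n \<Longrightarrow> {y, \<phi> (Inr i)} \<in> edges H"
      unfolding x_def y_def using V by (simp_all add: \<phi>(2)[symmetric])
  qed
  have "edges H \<subseteq> nsets {..<p} 2"
    using H by (simp add: subgraph_def complete_graph_def)
  then have fin: "finite (f ` edges H)"
    using finite_subset finite_imp_finite_nsets by blast
  \<comment> \<open>Apart from the colour of the spine at most one colour is left, which becomes
    \<open>d\<close>; if none is left, any \<open>d\<close> will do.\<close>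
  have "card (f ` edges H - {f {x, y}}) \<le> Suc 0"
    using E(1) H(2) by (simp add: fin)
  then obtain d where d: "f ` edges H \<subseteq> {f {x, y}, d}"
    using fin by (auto simp: card_le_Suc0_iff_eq) blast
  have "(\<lambda>i. \<phi> (Inr i)) ` {..<n} \<subseteq> pages {..<p} (\<lambda>u v. f {u, v}) x y d"
  proof
    fix w assume "w \<in> (\<lambda>i. \<phi> (Inr i)) ` {..<n}"
    then obtain i where i: "i < n" "w = \<phi> (Inr i)" by auto
    then have "w < p" "w \<noteq> x" "w \<noteq> y"
      using V im inj by (auto simp: x_def y_def inj_on_def)
    moreover have "f {x, w} \<in> {f {x, y}, d}" "f {y, w} \<in> {f {x, y}, d}"
      using d E(2,3)[OF i(1)] i(2) by blast+
    ultimately show "w \<in> pages {..<p} (\<lambda>u v. f {u, v}) x y d" by (simp add: pages_def)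
  qed
  then have "card ((\<lambda>i. \<phi> (Inr i)) ` {..<n}) \<le> card (pages {..<p} (\<lambda>u v. f {u, v}) x y d)"
    by (intro card_mono) (auto simp: pages_def)
  moreover have "inj_on (\<lambda>i. \<phi> (Inr i)) {..<n}"
    using inj V by (auto simp: inj_on_def)
  ultimately show ?R using xy by (auto simp: card_image)
next
  assume ?R
  then obtain x y d where xy: "x < p" "y < p" "x \<noteq> y"
    and n: "n \<le> card (pages {..<p} (\<lambda>u v. f {u, v}) x y d)" by blast
  from obtain_subset_with_card_n[OF n] obtain S
    where S: "S \<subseteq> pages {..<p} (\<lambda>u v. f {u, v}) x y d" "card S = n" "finite S" by metis
  obtain e where e: "bij_betw e {..<n} S"
    using ex_bij_betw_nat_finite[OF S(3)] S(2) by (auto simp: atLeast0LessThan)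
  then have eS: "e i \<in> S" if "i < n" for i using that by (auto simp: bij_betw_def)
  define \<phi> where "\<phi> = case_sum (\<lambda>a::nat. if a = 0 then x else y) e"
  have ew: "e i < p" "e i \<noteq> x" "e i \<noteq> y" "f {x, e i} \<in> {f {x, y}, d}" "f {y, e i} \<in> {f {x, y}, d}"
    if "i < n" for i
    using eS[OF that] S(1) by (auto simp: pages_def)
  have inj: "inj_on \<phi> (verts (book n))"
  proof (rule inj_onI)
    fix a b assume "a \<in> verts (book n)" "b \<in> verts (book n)" "\<phi> a = \<phi> b"
    moreover have "inj_on e {..<n}" using e by (simp add: bij_betw_def)
    ultimately show "a = b"
      using xy(3) ew(2,3)
      by (cases a; cases b)
        (auto simp: \<phi>_def verts_book less_2_cases_iff inj_on_def split: if_splits)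
  qed
  let ?H = "(\<phi> ` verts (book n), (`) \<phi> ` edges (book n))"
  have graph: "is_graph ?H" by (rule is_graph_image[OF is_graph_book inj])
  have verts: "\<phi> ` verts (book n) \<subseteq> {..<p}"
    using xy ew(1) by (auto simp: \<phi>_def verts_book)
  then have "nsets (\<phi> ` verts (book n)) 2 \<subseteq> nsets {..<p} 2" by (rule nsets_mono)
  then have "subgraph ?H (complete_graph p)"
    using graph verts by (auto simp: subgraph_def complete_graph_def is_graph_def)
  moreover have "isomorphic (book n) ?H" by (rule isomorphic_image[OF is_graph_book inj])
  moreover have "card (f ` edges ?H) \<le> 2"
  proof -
    have "f ` edges ?H \<subseteq> {f {x, y}, d}"
      by (auto simp: edges_book \<phi>_def less_2_cases_iff dest: ew(4,5))
    then have "card (f ` edges ?H) \<le> card {f {x, y}, d}" by (intro card_mono) auto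
    also have "\<dots> \<le> 2" by (simp add: card_insert_if)
    finally show ?thesis .
  qed
  ultimately show ?L by blast
qed

lemma gallai_coloring_gallai:
  assumes "gallai_coloring t p f"
  shows "gallai {..<p} (\<lambda>u v. f {u, v})"
  using assms
  by unfold_locales
    (auto simp: gallai_coloring_def rainbow_triangle_def complete_graph_def insert_commute)

lemma gallai_ramsey_property_8: "gallai_ramsey_property t 2 (book 4) 8"
  unfolding gallai_ramsey_property_def two_colored_book_iff
proof (intro allI impI, rule ccontr)
  fix f assume f: "gallai_coloring t 8 f"
    and neg: "\<not> (\<exists>x<8. \<exists>y<8. x \<noteq> y \<and> (\<exists>d. 4 \<le> card (pages {..<8} (\<lambda>u v. f {u, v}) x y d)))"
  have "card (pages {..<8} (\<lambda>u v. f {u, v}) x y d) \<le> 3"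
    if "x \<in> {..<8}" "y \<in> {..<8}" "x \<noteq> y" for x y d
  proof -
    have "\<not> 4 \<le> card (pages {..<8} (\<lambda>u v. f {u, v}) x y d)"
      using neg that unfolding lessThan_iff by blast
    then show ?thesis by simp
  qed
  then show False
    using gallai.no_bookfree_8[OF gallai_coloring_gallai[OF f]] by simp
qed

lemma gallai_ramsey_property_7: "gallai_ramsey_property 3 2 (book 4) 7"
  unfolding gallai_ramsey_property_def two_colored_book_iff
proof (intro allI impI, rule ccontr)
  fix f assume f: "gallai_coloring 3 7 f"
    and neg: "\<not> (\<exists>x<7. \<exists>y<7. x \<noteq> y \<and> (\<exists>d. 4 \<le> card (pages {..<7} (\<lambda>u v. f {u, v}) x y d)))"
  have "card (pages {..<7} (\<lambda>u v. f {u, v}) x y d) \<le> 3"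
    if "x \<in> {..<7}" "y \<in> {..<7}" "x \<noteq> y" for x y d
  proof -
    have "\<not> 4 \<le> card (pages {..<7} (\<lambda>u v. f {u, v}) x y d)"
      using neg that unfolding lessThan_iff by blast
    then show ?thesis by simp
  qed
  moreover have "f {u, v} \<in> {1..3}" if "u \<in> {..<7}" "v \<in> {..<7}" "u \<noteq> v" for u v
    using f that
    by (auto simp: gallai_coloring_def coloring_def complete_graph_def nsets_def Pi_iff)
  ultimately show False
    using gallai.no_bookfree_7[OF gallai_coloring_gallai[OF f], of "{1..3}"] by simp
qed

section \<open>Lower bounds and the least order\<close>

text \<open>A Gallai colouring restricts to \<open>{..<q}\<close>. Hence one bad colouring of order
  \<open>p\<close> excludes all smaller orders too.\<close>

lemma gallai_ramsey_property_mono: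
  assumes "gallai_ramsey_property t s G q" "q \<le> p"
  shows "gallai_ramsey_property t s G p"
  unfolding gallai_ramsey_property_def
proof (intro allI impI)
  have le: "nsets {..<q} 2 \<subseteq> nsets {..<p} 2" using assms(2) by (intro nsets_mono) auto
  fix f assume "gallai_coloring t p f"
  then have "gallai_coloring t q f"
    using assms(2) le unfolding gallai_coloring_def coloring_def rainbow_triangle_def complete_graph_def
    by (fastforce simp: Pi_iff)
  then obtain H where "subgraph H (complete_graph q)" "isomorphic G H" "card (f ` edges H) \<le> s"
    using assms(1) unfolding gallai_ramsey_property_def by blast
  then show "\<exists>H. subgraph H (complete_graph p) \<and> isomorphic G H \<and> card (f ` edges H) \<le> s"
    using assms(2) le by (intro exI[of _ H]) (auto simp: subgraph_def complete_graph_def)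
qed

text \<open>Quantifiers and counts over lists let evaluation decide the hypotheses for a concrete
  \<open>c\<close>. The palette size \<open>s\<close> is separate from \<open>t\<close>, so one
  colouring serves all larger \<open>t\<close>.\<close>

lemma not_gallai_ramsey_property:
  fixes c :: "nat \<Rightarrow> nat \<Rightarrow> nat"
  assumes sym: "\<And>u v. c u v = c v u"
    and colors: "\<forall>u\<in>set [0..<p]. \<forall>v\<in>set [0..<p]. u \<noteq> v \<longrightarrow> c u v \<in> set [1..<Suc s]" "s \<le> t"
    and tri: "\<forall>x\<in>set [0..<p]. \<forall>y\<in>set [0..<p]. \<forall>z\<in>set [0..<p]. distinct [x, y, z] \<longrightarrow>
      \<not> distinct [c x y, c x z, c y z]"
    and books: "\<forall>x\<in>set [0..<p]. \<forall>y\<in>set [0..<p]. \<forall>d\<in>set [1..<Suc s]. x \<noteq> y \<longrightarrow>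
      length (filter (\<lambda>w. w \<noteq> x \<and> w \<noteq> y \<and> c x w \<in> set [c x y, d] \<and> c y w \<in> set [c x y, d])
        [0..<p]) < n"
  shows "\<not> gallai_ramsey_property t 2 (book n) p"
proof -
  define f where "f e = c (Min e) (Max e)" for e
  have f: "f {u, v} = c u v" for u v
    using sym[of u v] by (cases "u \<le> v") (auto simp: f_def min_def max_def)
  have "gallai_coloring t p f"
    unfolding gallai_coloring_def
  proof
    have "f e \<in> {1..t}" if "e \<in> nsets {..<p} 2" for e
    proof -
      have e: "e \<subseteq> {..<p}" "card e = 2" using that by (auto simp: nsets_def)
      then obtain u v where "e = {u, v}" "u \<noteq> v" unfolding card_2_iff by blast
      moreover from this e have "u < p" "v < p" by auto
      ultimately show ?thesis using colors by (fastforce simp: f)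
    qed
    then show "coloring t p f" by (simp add: coloring_def complete_graph_def)
    show "\<not> rainbow_triangle p f"
    proof
      assume "rainbow_triangle p f"
      then obtain x y z where "x < p" "y < p" "z < p" "distinct [x, y, z]"
        "distinct [c x y, c x z, c y z]"
        unfolding rainbow_triangle_def complete_graph_def f by auto
      then show False using tri[rule_format, of x y z] by simp
    qed
  qed
  moreover have "card (pages {..<p} (\<lambda>u v. f {u, v}) x y d) < n"
    if xy: "x < p" "y < p" "x \<noteq> y" for x y d
  proof -
    \<comment> \<open>A colour \<open>d\<close> outside the palette adds no pages and may be
      replaced by the colour of the spine, which lies in the range of \<open>books\<close>.\<close>
    define d' where "d' = (if d \<in> set [1..<Suc s] then d else c x y)"
    have d': "d' \<in> set [1..<Suc s]" using colors(1) xy by (auto simp: d'_def)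
    let ?S = "filter (\<lambda>w. w \<noteq> x \<and> w \<noteq> y \<and> c x w \<in> set [c x y, d'] \<and> c y w \<in> set [c x y, d']) [0..<p]"
    have "pages {..<p} (\<lambda>u v. f {u, v}) x y d \<subseteq> set ?S"
    proof
      fix w assume w: "w \<in> pages {..<p} (\<lambda>u v. f {u, v}) x y d"
      then have "c x w \<in> set [1..<Suc s]" "c y w \<in> set [1..<Suc s]"
        using colors(1) xy by (auto simp: pages_def)
      then have "c x w \<in> {c x y, d'}" "c y w \<in> {c x y, d'}"
        using w unfolding pages_def f d'_def by (auto simp del: set_upt)
      then show "w \<in> set ?S" using w by (simp add: pages_def)
    qed
    then have "card (pages {..<p} (\<lambda>u v. f {u, v}) x y d) \<le> card (set ?S)"
      by (intro card_mono) auto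
    also have "\<dots> \<le> length ?S" by (rule card_length)
    also have "\<dots> < n" using books d' xy by auto
    finally show ?thesis .
  qed
  ultimately show ?thesis
    unfolding gallai_ramsey_property_def two_colored_book_iff by (auto simp: not_le)
qed

text \<open>The two-coloured pentagon with an apex joined to it in a third colour.\<close>

definition coloring6 :: "nat \<Rightarrow> nat \<Rightarrow> nat" where
  "coloring6 u v = (let a = min u v; b = max u v in
     if b = 5 then 3 else if b - a = 1 \<or> b - a = 4 then 1 else 2)"

lemma not_gallai_ramsey_property_6:
  assumes "t \<ge> 3" shows "\<not> gallai_ramsey_property t 2 (book 4) 6"
proof (rule not_gallai_ramsey_property[where c = coloring6 and s = 3])
  show "coloring6 u v = coloring6 v u" for u v
    by (simp add: coloring6_def min.commute max.commute)
qed (fact assms | code_simp)+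

text \<open>Two triangles in the colours 3 and 4, joined to each other in colour 2 and to an apex in
  colour 1. One triangle has two edges of colour 3, the other one two edges of colour 4.\<close>

definition coloring7 :: "nat \<Rightarrow> nat \<Rightarrow> nat" where
  "coloring7 u v = (let a = min u v; b = max u v in
     if b = 6 then 1 else if a < 3 \<and> 3 \<le> b then 2 else if a = 0 \<or> b = 4 then 3 else 4)"

lemma not_gallai_ramsey_property_7:
  assumes "t \<ge> 4" shows "\<not> gallai_ramsey_property t 2 (book 4) 7"
proof (rule not_gallai_ramsey_property[where c = coloring7 and s = 4])
  show "coloring7 u v = coloring7 v u" for u v
    by (simp add: coloring7_def min.commute max.commute)
qed (fact assms | code_simp)+

lemma weakened_gallai_ramsey_eqI:
  assumes "gallai_ramsey_property t s G (Suc p)" "\<not> gallai_ramsey_property t s G p"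
  shows "weakened_gallai_ramsey t s G = Suc p"
  unfolding weakened_gallai_ramsey_def
proof (rule Least_equality)
  show "Suc p \<le> q" if "gallai_ramsey_property t s G q" for q
    using gallai_ramsey_property_mono[OF that, of p] assms(2) by (meson not_less_eq_eq)
qed (fact assms(1))

theorem theorem3p2:
  fixes t :: nat
  assumes "t \<ge> 3"
  shows "weakened_gallai_ramsey t 2 (book 4) = (if t = 3 then 7 else 8)"
proof (cases "t = 3")
  case True
  then show ?thesis
    using weakened_gallai_ramsey_eqI[of 3 2 "book 4" 6] gallai_ramsey_property_7
      not_gallai_ramsey_property_6[of 3] by simp
next
  case False
  then show ?thesis
    using weakened_gallai_ramsey_eqI[of t 2 "book 4" 7] gallai_ramsey_property_8[of t]
      not_gallai_ramsey_property_7[of t] assms by simp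
qed

end
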